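(* Let $X$ be a first countable, locally compact Hausdorff space and $f\colon X\to X$ a continuous map. If $(X,f)$ has the open cover specification property for $s=2$ and admits a pair of distal points, then $(X,f)$ is Li--Yorke chaotic.
   Context: $\mathbb{N}=\{1,2,\dots\}$; for integers $a\le b$, $[a,b]$ denotes the set of integers $k$ with $a\le k\le b$. $(X,f)$ has the open cover specification property for $s=2$ if for every open cover $\mathcal{U}$ of $X$ there is $N\in\mathbb{N}$ such that for all $x_1,x_2\in X$ and all non-negative integers $a_1\le b_1<a_2\le b_2$ with $a_2-b_1\ge N$ there is $y\in X$ such that for each $i\in\{1,2\}$ and each $k\in[a_i,b_i]$ there is $U\in\mathcal{U}$ with $(f^k(y),f^k(x_i))\in U\times U$. A pair $(u,v)\in X\times X$ is a pair of distal points if there is an open cover $\mathcal{U}$ of $X$ such that for every $i\in\mathbb{N}\cup\{0\}$ and all $U_1,U_2\in\mathcal{U}$ with $f^i(u)\in U_1$ and $f^i(v)\in U_2$ one has $U_1\cap U_2=\varnothing$. For an open cover $\mathcal{U}$ of $X$, let $C_1(f)$ be the set of $(x,y)\in X^2$ for which there is a strictly increasing sequence $(n_j)$ in $\mathbb{N}$ such that for every $j$, $(f^{n_j}(x),f^{n_j}(y))\in U\times U$ for some $U\in\mathcal{U}$; let $C_2(f)$ be the set of $(x,y)\in X^2$ for which there is a strictly increasing sequence $(n_j)$ in $\mathbb{N}$ such that for every $j$, $(f^{n_j}(x),f^{n_j}(y))\notin U\times U$ for all $U\in\mathcal{U}$. $(X,f)$ is Li--Yorke chaotic if there are an open cover $\mathcal{U}$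 of $X$ and an uncountable set $S\subseteq X$ such that $(x,y)\in C_1(f)\cap C_2(f)$ for all distinct $x,y\in S$. *)

theory Defs
  imports "HOL-Analysis.Analysis"
begin

definition open_cover :: "'a topology \<Rightarrow> 'a set set \<Rightarrow> bool" where
  "open_cover X \<U> \<longleftrightarrow> (\<forall>U\<in>\<U>. openin X U) \<and> \<Union>\<U> = topspace X"

text \<open>Since \<open>b1 < a2\<close> is assumed, the subtraction below is not truncated.\<close>

definition open_cover_specification_2 :: "'a topology \<Rightarrow> ('a \<Rightarrow> 'a) \<Rightarrow> bool" where
  "open_cover_specification_2 X f \<longleftrightarrow>
     (\<forall>\<U>. open_cover X \<U> \<longrightarrow>
       (\<exists>N::nat. N \<ge> 1 \<and>
         (\<forall>x1\<in>topspace X. \<forall>x2\<in>topspace X. \<forall>a1 b1 a2 b2 :: nat.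
            a1 \<le> b1 \<and> b1 < a2 \<and> a2 \<le> b2 \<and> a2 - b1 \<ge> N \<longrightarrow>
            (\<exists>y\<in>topspace X.
               (\<forall>k\<in>{a1..b1}. \<exists>U\<in>\<U>. ((f ^^ k) y, (f ^^ k) x1) \<in> U \<times> U) \<and>
               (\<forall>k\<in>{a2..b2}. \<exists>U\<in>\<U>. ((f ^^ k) y, (f ^^ k) x2) \<in> U \<times> U)))))"

definition distal_pair :: "'a topology \<Rightarrow> ('a \<Rightarrow> 'a) \<Rightarrow> 'a \<Rightarrow> 'a \<Rightarrow> bool" where
  "distal_pair X f u v \<longleftrightarrow>
     u \<in> topspace X \<and> v \<in> topspace X \<and>
     (\<exists>\<U>. open_cover X \<U> \<and>
       (\<forall>i::nat. \<forall>U1\<in>\<U>. \<forall>U2\<in>\<U>.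
          (f ^^ i) u \<in> U1 \<and> (f ^^ i) v \<in> U2 \<longrightarrow> U1 \<inter> U2 = {}))"

text \<open>In the next two definitions the times \<open>n j\<close> range over the positive integers,
  whereas the index \<open>j\<close> of the sequence starts at 0.\<close>

definition C1 :: "'a topology \<Rightarrow> ('a \<Rightarrow> 'a) \<Rightarrow> 'a set set \<Rightarrow> ('a \<times> 'a) set" where
  "C1 X f \<U> = {(x, y) \<in> topspace X \<times> topspace X.
     \<exists>n :: nat \<Rightarrow> nat. strict_mono n \<and> (\<forall>j. n j \<ge> 1) \<and>
       (\<forall>j. \<exists>U\<in>\<U>. ((f ^^ n j) x, (f ^^ n j) y) \<in> U \<times> U)}"

definition C2 :: "'a topology \<Rightarrow> ('a \<Rightarrow> 'a) \<Rightarrow> 'a set set \<Rightarrow> ('a \<times> 'a) set" where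
  "C2 X f \<U> = {(x, y) \<in> topspace X \<times> topspace X.
     \<exists>n :: nat \<Rightarrow> nat. strict_mono n \<and> (\<forall>j. n j \<ge> 1) \<and>
       (\<forall>j. \<forall>U\<in>\<U>. ((f ^^ n j) x, (f ^^ n j) y) \<notin> U \<times> U)}"

definition Li_Yorke_chaotic :: "'a topology \<Rightarrow> ('a \<Rightarrow> 'a) \<Rightarrow> bool" where
  "Li_Yorke_chaotic X f \<longleftrightarrow>
     (\<exists>\<U> S. open_cover X \<U> \<and> S \<subseteq> topspace X \<and> uncountable S \<and>
       (\<forall>x\<in>S. \<forall>y\<in>S. x \<noteq> y \<longrightarrow> (x, y) \<in> C1 X f \<U> \<inter> C2 X f \<U>))"

end

theory Submission
  imports Defs
begin

text \<open>
  The specification property is only ever applied with one-point time intervals: if \<open>G\<close> is open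
  and nonempty and \<open>\<V>\<close> is a cover, then for all large \<open>m\<close> every \<open>f\<^sup>m x\<close> is \<open>\<V>\<close>-close to
  \<open>f\<^sup>m y\<close> for some \<open>y \<in> G\<close> (lemma \<open>reach\<close>).

  Since \<open>X\<close> need not be compact, the first task is to keep the distal pair from escaping to
  infinity. Let \<open>G\<close> lie in a compact set \<open>K\<close>. Then every point of \<open>f\<^sup>N(X)\<close> is \<open>\<V>\<close>-close to a point of
  the compact set \<open>f\<^sup>N(K)\<close>, where \<open>N\<close> depends on \<open>\<V>\<close>. A sequence of points
  \<open>f\<^bsup>m i\<^esup>(x i)\<close> with \<open>m\<close> strictly increasing and without cluster point would be closed and discrete,
  and then a cover could isolate its \<open>i\<close>-th point from all of the compact sets \<open>f\<^sup>k(K)\<close>, \<open>k \<le> i\<close>,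
  that do not contain it; this contradicts the closeness for large \<open>i\<close>. So all such sequences have
  cluster points (lemma \<open>orbit_sequence_clusters\<close>). First countability turns the cluster point of one
  orbit into a convergent subsequence, along which the second orbit clusters too; hence the pairs
  \<open>(f\<^sup>m u, f\<^sup>m v)\<close> cluster at some \<open>(a, b)\<close>, and distality forces \<open>a \<noteq> b\<close>.

  Choose open neighbourhoods \<open>A\<close>, \<open>B\<close> of \<open>a\<close>, \<open>b\<close> inside disjoint closed sets \<open>DA\<close>, \<open>DB\<close>. Shadowing
  \<open>u\<close> or \<open>v\<close> at the times when the pair is near \<open>(a, b)\<close>, every nonempty open set contains points
  that are in \<open>A\<close>, and points that are in \<open>B\<close>, at one common time. Iterating this and using
  compactness gives times \<open>t 0 < t 1 < \<dots>\<close> such that every 0-1 sequence is realised, by some point,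
  as its itinerary through \<open>DA\<close> and \<open>DB\<close> at these times (lemma \<open>itineraries\<close>). Two points in
  the same one of these sets share a member of the cover by the complements of \<open>DA\<close> and \<open>DB\<close>, two
  points in different ones do not. An uncountable family of 0-1 sequences any two of which agree
  infinitely often and differ infinitely often therefore yields the scrambled set.
\<close>

section \<open>Reaching orbits from open sets\<close>

lemma open_cover_common_refinement:
  assumes "open_cover X \<U>" "open_cover X \<V>"
  shows "open_cover X {U \<inter> V |U V. U \<in> \<U> \<and> V \<in> \<V>}"
proof -
  have "\<Union>{U \<inter> V |U V. U \<in> \<U> \<and> V \<in> \<V>} = \<Union>\<U> \<inter> \<Union>\<V>" by blast
  then show ?thesis using assms unfolding open_cover_def by (auto intro: openin_Int)
qed

lemma open_cover_open_closed:
  assumes "openin X U" "closedin X C" "C \<subseteq> U"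
  shows "open_cover X {U, topspace X - C}"
  using assms openin_subset[OF assms(1)] by (auto simp: open_cover_def closedin_def)

lemma continuous_map_funpow:
  assumes "continuous_map X X f"
  shows "continuous_map X X (f ^^ n)"
proof (induction n)
  case (Suc n)
  then show ?case using continuous_map_compose[OF Suc assms] by (simp only: funpow.simps)
qed (simp add: id_def)

locale spec2_system =
  fixes X :: "'a topology" and f :: "'a \<Rightarrow> 'a"
  assumes locally_compact: "locally_compact_space X"
    and Hausdorff: "Hausdorff_space X"
    and continuous: "continuous_map X X f"
    and spec: "open_cover_specification_2 X f"
begin

lemma funpow_in_topspace: "x \<in> topspace X \<Longrightarrow> (f ^^ n) x \<in> topspace X"
  using continuous_map_funpow[OF continuous, of n] by (auto simp: continuous_map_def)

lemma nbhd_closed_inside: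
  assumes "openin X W" "x \<in> W"
  obtains U C where "openin X U" "closedin X C" "compactin X C" "x \<in> U" "U \<subseteq> C" "C \<subseteq> W"
proof -
  have "neighbourhood_base_of (\<lambda>C. compactin X C \<and> closedin X C) X"
    using locally_compact locally_compact_Hausdorff_imp_regular_space[OF locally_compact Hausdorff]
      locally_compact_regular_space_neighbourhood_base by blast
  then show thesis using assms that unfolding neighbourhood_base_of by metis
qed

text \<open>Specification only provides a \<open>y\<close> that is close to a given \<open>p\<close> at time 0. Refining \<open>\<V>\<close> by
  the cover \<open>{G, X - {p}}\<close>, in which only \<open>G\<close> contains \<open>p\<close>, turns this closeness into \<open>y \<in> G\<close>.\<close>

lemma reach:
  assumes G: "openin X G" "G \<noteq> {}" and \<V>: "open_cover X \<V>"
  obtains N where "N \<ge> 1"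
    "\<And>m x. m \<ge> N \<Longrightarrow> x \<in> topspace X \<Longrightarrow> \<exists>y\<in>G. \<exists>V\<in>\<V>. (f ^^ m) y \<in> V \<and> (f ^^ m) x \<in> V"
proof -
  obtain p where p: "p \<in> G" using G by blast
  have pX: "p \<in> topspace X" using p openin_subset[OF G(1)] by blast
  define \<W> where "\<W> = {U \<inter> V |U V. U \<in> {G, topspace X - {p}} \<and> V \<in> \<V>}"
  have "open_cover X \<W>"
    unfolding \<W>_def
    by (intro open_cover_common_refinement[OF _ \<V>]
        open_cover_open_closed[OF G(1) closedin_Hausdorff_singleton[OF Hausdorff pX]])
      (use p in simp)
  from spec[unfolded open_cover_specification_2_def, rule_format, OF this]
  obtain N :: nat where tr: "N \<ge> 1 \<and> (\<forall>x1\<in>topspace X. \<forall>x2\<in>topspace X. \<forall>a1 b1 a2 b2 :: nat.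
      a1 \<le> b1 \<and> b1 < a2 \<and> a2 \<le> b2 \<and> a2 - b1 \<ge> N \<longrightarrow>
      (\<exists>y\<in>topspace X. (\<forall>k\<in>{a1..b1}. \<exists>U\<in>\<W>. ((f ^^ k) y, (f ^^ k) x1) \<in> U \<times> U) \<and>
        (\<forall>k\<in>{a2..b2}. \<exists>U\<in>\<W>. ((f ^^ k) y, (f ^^ k) x2) \<in> U \<times> U)))" ..
  then have N: "N \<ge> 1" by (rule conjunct1)
  show thesis
  proof (rule that[OF N])
    fix m x assume m: "m \<ge> N" and x: "x \<in> topspace X"
    obtain y where y0: "\<exists>U\<in>\<W>. y \<in> U \<and> p \<in> U"
      and ym: "\<exists>U\<in>\<W>. (f ^^ m) y \<in> U \<and> (f ^^ m) x \<in> U"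
      using tr[THEN conjunct2, rule_format, OF pX x, of 0 0 m m] m N by auto
    have "y \<in> G" using y0 unfolding \<W>_def by auto
    moreover have "\<exists>V\<in>\<V>. (f ^^ m) y \<in> V \<and> (f ^^ m) x \<in> V"
      using ym unfolding \<W>_def by auto
    ultimately show "\<exists>y\<in>G. \<exists>V\<in>\<V>. (f ^^ m) y \<in> V \<and> (f ^^ m) x \<in> V" by blast
  qed
qed

text \<open>Closeness becomes membership as soon as the orbit followed lies in a closed set
  inside the open target.\<close>

lemma hit_open_set:
  assumes G: "openin X G" "G \<noteq> {}" and C: "openin X C" "closedin X E" "E \<subseteq> C"
    and x: "x \<in> topspace X"
  obtains N where "\<And>m. m \<ge> N \<Longrightarrow> (f ^^ m) x \<in> E \<Longrightarrow> \<exists>y\<in>G. (f ^^ m) y \<in> C"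
proof -
  obtain N where N: "\<And>m. m \<ge> N \<Longrightarrow>
      \<exists>y\<in>G. \<exists>V\<in>{C, topspace X - E}. (f ^^ m) y \<in> V \<and> (f ^^ m) x \<in> V"
    using reach[OF G open_cover_open_closed[OF C]] x by metis
  show thesis
  proof (rule that)
    fix m assume "m \<ge> N" "(f ^^ m) x \<in> E"
    then show "\<exists>y\<in>G. (f ^^ m) y \<in> C" using N[of m] by auto
  qed
qed

section \<open>Cluster points of orbits\<close>

text \<open>A failure of clustering gives a neighbourhood \<open>R z\<close> of each point that meets the sequence
  finitely often. It is shrunk to \<open>Q z\<close>, which contains no term of the sequence except possibly \<open>z\<close>
  itself, and which avoids all \<open>f\<^sup>k(K)\<close> not containing \<open>z\<close> for \<open>k\<close> up to the last index in \<open>R z\<close>.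
  The gap \<open>N\<close> of the resulting cover is fixed only after the cover, but the \<open>i\<close>-th term
  has been isolated from all \<open>f\<^sup>k(K)\<close> with \<open>k \<le> i\<close>, so from \<open>f\<^sup>N(K)\<close> when \<open>i\<close> is large.\<close>

lemma orbit_sequence_clusters:
  assumes m: "strict_mono m" and x: "\<And>i::nat. x i \<in> topspace X"
  obtains a where "a \<in> topspace X"
    "\<And>W. openin X W \<Longrightarrow> a \<in> W \<Longrightarrow> infinite {i. (f ^^ m i) (x i) \<in> W}"
proof (rule ccontr)
  note cluster = that
  assume no: "\<not> thesis"
  define w where "w i = (f ^^ m i) (x i)" for i
  have wX: "w i \<in> topspace X" for i unfolding w_def using x funpow_in_topspace by blast
  have "\<exists>W. openin X W \<and> z \<in> W \<and> finite {i. w i \<in> W}" if "z \<in> topspace X" for z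
  proof (rule ccontr)
    assume "\<not> ?thesis"
    then have "infinite {i. w i \<in> W}" if "openin X W" "z \<in> W" for W using that by blast
    then show False using no cluster[OF \<open>z \<in> topspace X\<close>] unfolding w_def by blast
  qed
  then obtain R where R: "\<And>z. z \<in> topspace X \<Longrightarrow> openin X (R z)"
    "\<And>z. z \<in> topspace X \<Longrightarrow> z \<in> R z"
    "\<And>z. z \<in> topspace X \<Longrightarrow> finite {i. w i \<in> R z}" by metis
  obtain G K where G: "openin X G" "G \<noteq> {}" and K: "compactin X K" "G \<subseteq> K"
    by (rule nbhd_closed_inside[OF openin_topspace wX[of 0]]) blast
  define L where "L k = (f ^^ k) ` K" for k
  have L: "compactin X (L k)" for k
    unfolding L_def using image_compactin[OF K(1) continuous_map_funpow[OF continuous]] .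
  have Lcl: "closedin X (L k)" for k using compactin_imp_closedin[OF Hausdorff L] .
  define j where "j z = Max (insert 0 {i. w i \<in> R z})" for z
  define Q where "Q z = R z - (w ` {i. w i \<in> R z} - {z}) - \<Union>{L k |k. k \<le> j z \<and> z \<notin> L k}" for z
  have cover: "open_cover X (Q ` topspace X)"
  proof -
    have "openin X (Q z) \<and> z \<in> Q z" if z: "z \<in> topspace X" for z
    proof -
      have "finite (w ` {i. w i \<in> R z} - {z})" by (intro finite_Diff finite_imageI R(3)[OF z])
      moreover have "w ` {i. w i \<in> R z} - {z} \<subseteq> topspace X" using wX by blast
      ultimately have 1: "closedin X (w ` {i. w i \<in> R z} - {z})"
        by (intro closedin_Hausdorff_finite[OF Hausdorff])
      have "finite {L k |k. k \<le> j z \<and> z \<notin> L k}"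
        by (rule finite_subset[of _ "L ` {..j z}"]) auto
      then have 2: "closedin X (\<Union>{L k |k. k \<le> j z \<and> z \<notin> L k})"
        by (rule closedin_Union) (use Lcl in blast)
      have "openin X (Q z)" unfolding Q_def by (intro openin_diff R(1)[OF z] 1 2)
      moreover have "z \<in> Q z" unfolding Q_def using R(2)[OF z] by blast
      ultimately show ?thesis by blast
    qed
    then have "openin X (Q z)" "z \<in> Q z" "Q z \<subseteq> topspace X" if "z \<in> topspace X" for z
      using that openin_subset by auto
    then show ?thesis unfolding open_cover_def by auto
  qed
  have isolated: "k \<le> i \<Longrightarrow> w i \<in> Q z \<Longrightarrow> q \<in> Q z \<Longrightarrow> q \<in> L k \<Longrightarrow> w i \<in> L k"
    if z: "z \<in> topspace X" for k i z q
  proof (rule ccontr)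
    assume k: "k \<le> i" and wi: "w i \<in> Q z" and q: "q \<in> Q z" "q \<in> L k" and n: "w i \<notin> L k"
    have "w i = z" using wi unfolding Q_def by auto
    moreover have "i \<le> j z"
      unfolding j_def by (rule Max_ge) (use R(3)[OF z] wi in \<open>auto simp: Q_def\<close>)
    ultimately have "L k \<in> {L k |k. k \<le> j z \<and> z \<notin> L k}" using k n by auto
    then have "q \<in> \<Union>{L k |k. k \<le> j z \<and> z \<notin> L k}" using q(2) by (rule UnionI)
    moreover have "q \<notin> \<Union>{L k |k. k \<le> j z \<and> z \<notin> L k}"
      using q(1) unfolding Q_def by (rule DiffE)
    ultimately show False by contradiction
  qed
  obtain N where N: "\<And>n x. n \<ge> N \<Longrightarrow> x \<in> topspace X \<Longrightarrow>
      \<exists>y\<in>G. \<exists>V\<in>Q ` topspace X. (f ^^ n) y \<in> V \<and> (f ^^ n) x \<in> V"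
    by (rule reach[OF G cover]) blast
  have late: "w i \<in> L N" if i: "i \<ge> N" for i
  proof -
    have mi: "m i \<ge> N" using i strict_mono_imp_increasing[OF m, of i] by linarith
    \<comment> \<open>At time \<open>N\<close> the point followed is exactly \<open>w i\<close>.\<close>
    define x' where "x' = (f ^^ (m i - N)) (x i)"
    have "(f ^^ N) x' = w i"
      unfolding x'_def w_def using mi by (metis comp_apply funpow_add le_add_diff_inverse)
    moreover have "x' \<in> topspace X" unfolding x'_def using x funpow_in_topspace by blast
    ultimately obtain y z where y: "y \<in> G" and z: "z \<in> topspace X" "(f ^^ N) y \<in> Q z" "w i \<in> Q z"
      using N[OF order_refl, of x'] by auto
    have "(f ^^ N) y \<in> L N" unfolding L_def using y K(2) by blast
    then show ?thesis by (rule isolated[OF z(1) i z(3,2)])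
  qed
  \<comment> \<open>The compact set \<open>L N\<close> contains only finitely many terms, as each \<open>R z\<close> does.\<close>
  have "L N \<subseteq> \<Union>(R ` topspace X)" using R(2) compactin_subset_topspace[OF L[of N]] by auto
  then obtain \<F> where \<F>: "finite \<F>" "\<F> \<subseteq> R ` topspace X" "L N \<subseteq> \<Union>\<F>"
    using compactinD[OF L[of N], of "R ` topspace X"] R(1) by auto
  obtain F where F: "F \<subseteq> topspace X" "finite F" "\<F> = R ` F"
    using finite_subset_image[OF \<F>(1,2)] by metis
  have "{N..} \<subseteq> (\<Union>z\<in>F. {i. w i \<in> R z})"
  proof
    fix i assume "i \<in> {N..}"
    then have "w i \<in> \<Union>(R ` F)" using late \<F>(3) F(3) by auto
    then show "i \<in> (\<Union>z\<in>F. {i. w i \<in> R z})" by simp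
  qed
  moreover have "finite (\<Union>z\<in>F. {i. w i \<in> R z})" using F(1,2) R(3) by auto
  ultimately have "finite {N..}" by (rule finite_subset)
  then show False using infinite_Ici by contradiction
qed

lemma orbit_pair_clusters:
  assumes fc: "first_countable X" and u: "u \<in> topspace X" and v: "v \<in> topspace X"
  obtains a b where "a \<in> topspace X" "b \<in> topspace X"
    "\<And>A B. openin X A \<Longrightarrow> a \<in> A \<Longrightarrow> openin X B \<Longrightarrow> b \<in> B \<Longrightarrow>
      infinite {m. (f ^^ m) u \<in> A \<and> (f ^^ m) v \<in> B}"
proof -
  obtain a where a: "a \<in> topspace X"
    and ua: "\<And>W. openin X W \<Longrightarrow> a \<in> W \<Longrightarrow> infinite {i. (f ^^ i) u \<in> W}"
    by (rule orbit_sequence_clusters[of "\<lambda>i. i" "\<lambda>_. u"]) (auto simp: strict_mono_def u)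
  obtain \<B> where \<B>: "countable \<B>" "\<And>V. V \<in> \<B> \<Longrightarrow> openin X V"
    "\<And>W. openin X W \<Longrightarrow> a \<in> W \<Longrightarrow> \<exists>V\<in>\<B>. a \<in> V \<and> V \<subseteq> W"
    using fc[unfolded first_countable_def, rule_format, OF a] by metis
  define \<B>' where "\<B>' = {V \<in> \<B>. a \<in> V}"
  have "\<B>' \<noteq> {}" unfolding \<B>'_def using \<B>(3)[OF openin_topspace a] by auto
  moreover have "countable \<B>'" unfolding \<B>'_def using \<B>(1) by simp
  ultimately obtain E :: "nat \<Rightarrow> 'a set" where E: "range E = \<B>'" by (metis range_from_nat_into)
  have "E n \<in> \<B>'" for n using E by blast
  then have E': "openin X (E n)" "a \<in> E n" for n using \<B>(2) unfolding \<B>'_def by auto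
  have V: "openin X (\<Inter>k\<le>n. E k)" "a \<in> (\<Inter>k\<le>n. E k)" for n
    using E' by (auto intro!: openin_INT2)
  have "\<exists>m. \<forall>n. (f ^^ m n) u \<in> (\<Inter>k\<le>n. E k) \<and> m n < m (Suc n)"
  proof (rule dependent_nat_choice)
    show "\<exists>i. (f ^^ i) u \<in> (\<Inter>k\<le>0. E k)"
      using ua[OF V(1) V(2), of 0] not_finite_existsD by blast
    show "\<exists>j. (f ^^ j) u \<in> (\<Inter>k\<le>Suc n. E k) \<and> i < j" for i n
      using ua[OF V(1) V(2), of "Suc n"] unfolding infinite_nat_iff_unbounded by blast
  qed
  then obtain m where m: "\<And>n. (f ^^ m n) u \<in> (\<Inter>k\<le>n. E k)" "\<And>n. m n < m (Suc n)" by blast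
  have sm: "strict_mono m" using m(2) by (simp add: strict_mono_Suc_iff)
  obtain b where b: "b \<in> topspace X"
    and vb: "\<And>W. openin X W \<Longrightarrow> b \<in> W \<Longrightarrow> infinite {i. (f ^^ m i) v \<in> W}"
    by (rule orbit_sequence_clusters[OF sm, of "\<lambda>_. v"]) (auto simp: v)
  show thesis
  proof (rule that[OF a b])
    fix A B assume A: "openin X A" "a \<in> A" and B: "openin X B" "b \<in> B"
    obtain W where "W \<in> \<B>'" "W \<subseteq> A" using \<B>(3)[OF A] unfolding \<B>'_def by auto
    then obtain k where k: "E k \<subseteq> A" using E by (metis rangeE)
    define I where "I = {i. (f ^^ m i) v \<in> B} - {..<k}"
    have "infinite I" unfolding I_def using vb[OF B] by simp
    moreover have "inj_on m I" using sm by (rule strict_mono_imp_inj_on)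
    ultimately have inf: "infinite (m ` I)" by (simp add: finite_image_iff)
    have "(f ^^ m i) u \<in> A \<and> (f ^^ m i) v \<in> B" if "i \<in> I" for i
      using that k m(1)[of i] unfolding I_def by auto
    then have "m ` I \<subseteq> {m. (f ^^ m) u \<in> A \<and> (f ^^ m) v \<in> B}" by auto
    then show "infinite {m. (f ^^ m) u \<in> A \<and> (f ^^ m) v \<in> B}"
      using inf by (rule infinite_super)
  qed
qed

section \<open>Prescribed itineraries\<close>

text \<open>The times have to serve all itineraries at once. After \<open>n\<close> steps there are at most \<open>2\<^sup>n\<close>
  nonempty open sets of points, one for each prescribed beginning; the next time is chosen so late
  that both targets can be reached from all of them. Compactness passes from finite to infinite
  itineraries, for which the open targets \<open>C e\<close> are replaced by closed \<open>D e\<close>.\<close>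

lemma itineraries:
  fixes C D :: "bool \<Rightarrow> 'a set"
  assumes M: "infinite M"
    and C: "\<And>e. openin X (C e)" and D: "\<And>e. closedin X (D e)" and CD: "\<And>e. C e \<subseteq> D e"
    and hit: "\<And>G e. openin X G \<Longrightarrow> G \<noteq> {} \<Longrightarrow> \<exists>N. \<forall>m\<ge>N. m \<in> M \<longrightarrow> (\<exists>y\<in>G. (f ^^ m) y \<in> C e)"
    and ne: "topspace X \<noteq> {}"
  obtains t :: "nat \<Rightarrow> nat" where "strict_mono t" "\<And>n. t n \<ge> 1"
    "\<And>\<sigma>. \<exists>y\<in>topspace X. \<forall>n. (f ^^ t n) y \<in> D (\<sigma> n)"
proof -
  obtain G0 K where G0: "openin X G0" "G0 \<noteq> {}" and K: "compactin X K" "G0 \<subseteq> K"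
  proof -
    obtain z where "z \<in> topspace X" using ne by blast
    then show thesis by (rule nbhd_closed_inside[OF openin_topspace]) (use that in blast)
  qed
  have G0X: "G0 \<subseteq> topspace X" using openin_subset[OF G0(1)] .
  define pull where "pull t G e = {y \<in> G. (f ^^ t) y \<in> C e}" for t G e
  have pull_open: "openin X (pull t G e)" if "openin X G" for t G e
  proof -
    have "pull t G e = G \<inter> {y \<in> topspace X. (f ^^ t) y \<in> C e}"
      unfolding pull_def using openin_subset[OF that] by auto
    then show ?thesis
      using that openin_continuous_map_preimage[OF continuous_map_funpow[OF continuous] C]
      by (auto intro: openin_Int)
  qed
  define good where
    "good \<G> \<longleftrightarrow> finite \<G> \<and> (\<forall>G\<in>\<G>. openin X G \<and> G \<noteq> {})" for \<G> :: "'a set set"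
  have "\<exists>s. \<forall>n. ((n = 0 \<longrightarrow> s n = (0, {G0})) \<and> good (snd (s n))) \<and>
    (fst (s n) < fst (s (Suc n)) \<and>
     snd (s (Suc n)) = (\<lambda>(G, e). pull (fst (s (Suc n))) G e) ` (snd (s n) \<times> UNIV))"
  proof (rule dependent_nat_choice)
    show "\<exists>s. (0 = 0 \<longrightarrow> s = (0, {G0})) \<and> good (snd s)" using G0 unfolding good_def by auto
  next
    fix s :: "nat \<times> 'a set set" and n :: nat
    assume "(n = 0 \<longrightarrow> s = (0, {G0})) \<and> good (snd s)"
    then have g: "good (snd s)" by blast
    then obtain N where N: "\<And>G e. G \<in> snd s \<Longrightarrow> \<forall>m\<ge>N G e. m \<in> M \<longrightarrow> (\<exists>y\<in>G. (f ^^ m) y \<in> C e)"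
      using hit unfolding good_def by metis
    have fin: "finite (snd s \<times> (UNIV :: bool set))" using g unfolding good_def by auto
    define T where "T = Max (insert (fst s) ((\<lambda>(G, e). N G e) ` (snd s \<times> UNIV)))"
    obtain t where t: "t \<in> M" "t > T" using M unfolding infinite_nat_iff_unbounded by blast
    have "fst s \<le> T" unfolding T_def by (rule Max_ge) (use fin in auto)
    then have "fst s < t" using t(2) by simp
    have Nt: "N G e \<le> t" if "G \<in> snd s" for G e
    proof -
      have "N G e \<le> T" unfolding T_def by (rule Max_ge) (use fin that in auto)
      then show ?thesis using t(2) by simp
    qed
    define \<G>' where "\<G>' = (\<lambda>(G, e). pull t G e) ` (snd s \<times> UNIV)"
    have "openin X (pull t G e) \<and> pull t G e \<noteq> {}" if "G \<in> snd s" for G e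
    proof
      show "openin X (pull t G e)" using g that pull_open unfolding good_def by auto
      show "pull t G e \<noteq> {}"
        using N[OF that, rule_format, OF Nt[OF that] t(1)] unfolding pull_def by auto
    qed
    moreover have "finite \<G>'" unfolding \<G>'_def using fin by (rule finite_imageI)
    ultimately have "good \<G>'" unfolding good_def \<G>'_def by auto
    then show "\<exists>s'. ((Suc n = 0 \<longrightarrow> s' = (0, {G0})) \<and> good (snd s')) \<and>
       (fst s < fst s' \<and> snd s' = (\<lambda>(G, e). pull (fst s') G e) ` (snd s \<times> UNIV))"
      using \<open>fst s < t\<close> by (intro exI[of _ "(t, \<G>')"]) (simp add: \<G>'_def)
  qed
  then obtain s where s0: "s 0 = (0, {G0})" and sg: "\<And>n. good (snd (s n))"
    and slt: "\<And>n. fst (s n) < fst (s (Suc n))"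
    and sS: "\<And>n. snd (s (Suc n)) = (\<lambda>(G, e). pull (fst (s (Suc n))) G e) ` (snd (s n) \<times> UNIV)"
    by blast
  define t where "t n = fst (s (Suc n))" for n
  have nonempty: "G \<noteq> {}" if "G \<in> snd (s n)" for G n
    using sg[of n] that unfolding good_def by auto
  have begin_ne: "\<exists>y\<in>G0. \<forall>i<n. (f ^^ t i) y \<in> C (\<sigma> i)" for \<sigma> n
  proof -
    have "{y \<in> G0. \<forall>i<n. (f ^^ t i) y \<in> C (\<sigma> i)} \<in> snd (s n)"
    proof (induction n)
      case 0
      then show ?case using s0 by simp
    next
      case (Suc n)
      have "{y \<in> G0. \<forall>i<Suc n. (f ^^ t i) y \<in> C (\<sigma> i)} =
        pull (t n) {y \<in> G0. \<forall>i<n. (f ^^ t i) y \<in> C (\<sigma> i)} (\<sigma> n)"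
        unfolding pull_def by (auto simp: less_Suc_eq)
      then show ?case
        unfolding sS t_def[symmetric] by (intro rev_image_eqI[OF SigmaI[OF Suc UNIV_I]]) simp
    qed
    then have "{y \<in> G0. \<forall>i<n. (f ^^ t i) y \<in> C (\<sigma> i)} \<noteq> {}" by (rule nonempty)
    then show ?thesis by (simp add: Bex_def)
  qed
  show thesis
  proof (rule that)
    show "strict_mono t" unfolding t_def using slt by (simp add: strict_mono_Suc_iff)
    show "t n \<ge> 1" for n unfolding t_def using slt[of n] by linarith
    fix \<sigma> :: "nat \<Rightarrow> bool"
    define P where "P n = {y \<in> topspace X. (f ^^ t n) y \<in> D (\<sigma> n)}" for n
    have "closedin X (P n)" for n
      unfolding P_def using closedin_continuous_map_preimage[OF continuous_map_funpow[OF continuous] D] .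
    moreover have "K \<inter> \<Inter>\<F> \<noteq> {}" if \<F>: "finite \<F>" "\<F> \<subseteq> range P" for \<F>
    proof -
      obtain I where I: "finite I" "\<F> = P ` I" using \<F> finite_subset_image by metis
      obtain n where n: "I \<subseteq> {..<n}" using I(1) finite_nat_iff_bounded by blast
      obtain y where "y \<in> G0" "\<forall>i<n. (f ^^ t i) y \<in> C (\<sigma> i)" using begin_ne by blast
      then have "y \<in> K \<inter> \<Inter>\<F>" using n I(2) K(2) G0X CD unfolding P_def by blast
      then show ?thesis by blast
    qed
    ultimately have "K \<inter> \<Inter>(range P) \<noteq> {}" using K(1) unfolding compactin_fip by blast
    then show "\<exists>y\<in>topspace X. \<forall>n. (f ^^ t n) y \<in> D (\<sigma> n)" unfolding P_def by blast
  qed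
qed

end

section \<open>The scrambled set\<close>

text \<open>Repeating each bit of \<open>g\<close> infinitely often makes any difference between two sequences recur;
  interleaving a constant sequence makes agreement recur. The pairing function provides infinitely
  many disjoint infinite rows: row 0 is constant and row \<open>Suc i\<close> carries \<open>g i\<close>.\<close>

definition spread :: "(nat \<Rightarrow> bool) \<Rightarrow> nat \<Rightarrow> bool" where
  "spread g k = (case fst (prod_decode k) of 0 \<Rightarrow> False | Suc i \<Rightarrow> g i)"

lemma infinite_prod_encode_row: "infinite (range (\<lambda>l. prod_encode (i, l)))"
  by (intro range_inj_infinite) (auto simp: inj_def)

lemma infinite_spread_eq: "infinite {k. spread g k = spread h k}"
  by (rule infinite_super[OF _ infinite_prod_encode_row[of 0]]) (auto simp: spread_def)

lemma infinite_spread_neq: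
  assumes "g \<noteq> h"
  shows "infinite {k. spread g k \<noteq> spread h k}"
proof -
  obtain i where "g i \<noteq> h i" using assms by blast
  then show ?thesis
    by (intro infinite_super[OF _ infinite_prod_encode_row[of "Suc i"]]) (auto simp: spread_def)
qed

lemma uncountable_bool_sequences: "uncountable (UNIV :: (nat \<Rightarrow> bool) set)"
proof -
  have "range F \<noteq> UNIV" for F :: "nat \<Rightarrow> nat \<Rightarrow> bool"
  proof
    assume "range F = UNIV"
    then have "(\<lambda>k. \<not> F k k) \<in> range F" by simp
    then obtain n where n: "(\<lambda>k. \<not> F k k) = F n" by (rule rangeE)
    show False using fun_cong[OF n, of n] by simp
  qed
  then show ?thesis unfolding uncountable_def by simp
qed

lemma subsequence_of_infinite:
  assumes "infinite I" "strict_mono (t :: nat \<Rightarrow> nat)"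
  obtains n :: "nat \<Rightarrow> nat" where "strict_mono n" "\<And>j. n j \<in> t ` I"
proof (rule that)
  show "strict_mono (t \<circ> enumerate I)"
    using assms by (intro strict_mono_o) (auto simp: strict_mono_enumerate)
  show "(t \<circ> enumerate I) j \<in> t ` I" for j
    using enumerate_in_set[OF assms(1)] by simp
qed

theorem corollary4p3:
  fixes X :: "'a topology" and f :: "'a \<Rightarrow> 'a"
  assumes "first_countable X"
    and "locally_compact_space X"
    and "Hausdorff_space X"
    and "continuous_map X X f"
    and "open_cover_specification_2 X f"
    and "\<exists>u v. distal_pair X f u v"
  shows "Li_Yorke_chaotic X f"
proof -
  interpret spec2_system X f using assms by unfold_locales
  obtain u v \<U> where u: "u \<in> topspace X" and v: "v \<in> topspace X" and \<U>: "open_cover X \<U>"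
    and distal: "\<And>i U1 U2. U1 \<in> \<U> \<Longrightarrow> U2 \<in> \<U> \<Longrightarrow> (f ^^ i) u \<in> U1 \<Longrightarrow> (f ^^ i) v \<in> U2 \<Longrightarrow> U1 \<inter> U2 = {}"
    using assms(6) unfolding distal_pair_def by metis
  obtain a b where a: "a \<in> topspace X" and b: "b \<in> topspace X"
    and ab: "\<And>A B. openin X A \<Longrightarrow> a \<in> A \<Longrightarrow> openin X B \<Longrightarrow> b \<in> B \<Longrightarrow>
      infinite {m. (f ^^ m) u \<in> A \<and> (f ^^ m) v \<in> B}"
    by (rule orbit_pair_clusters[OF assms(1) u v]) blast
  have "a \<noteq> b"
  proof
    assume "a = b"
    obtain U where U: "U \<in> \<U>" "a \<in> U" "openin X U" using \<U> a unfolding open_cover_def by blast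
    have "infinite {m. (f ^^ m) u \<in> U \<and> (f ^^ m) v \<in> U}"
      using ab[OF U(3,2) U(3)] U(2) \<open>a = b\<close> by simp
    then obtain m where "(f ^^ m) u \<in> U" "(f ^^ m) v \<in> U" using not_finite_existsD by blast
    then show False using distal[OF U(1) U(1)] by blast
  qed
  then obtain A0 B0 where AB0: "openin X A0" "openin X B0" "a \<in> A0" "b \<in> B0" "A0 \<inter> B0 = {}"
    using assms(3) a b unfolding Hausdorff_space_def disjnt_def by metis
  \<comment> \<open>Two shrinkings: itineraries are prescribed in \<open>A \<subseteq> DA\<close>, while the orbit that is followed
    has to be in the smaller \<open>EA\<close>.\<close>
  obtain A DA where A: "openin X A" "closedin X DA" "a \<in> A" "A \<subseteq> DA" "DA \<subseteq> A0"
    by (rule nbhd_closed_inside[OF AB0(1,3)])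
  obtain A' EA where A': "openin X A'" "closedin X EA" "a \<in> A'" "A' \<subseteq> EA" "EA \<subseteq> A"
    by (rule nbhd_closed_inside[OF A(1,3)])
  obtain B DB where B: "openin X B" "closedin X DB" "b \<in> B" "B \<subseteq> DB" "DB \<subseteq> B0"
    by (rule nbhd_closed_inside[OF AB0(2,4)])
  obtain B' EB where B': "openin X B'" "closedin X EB" "b \<in> B'" "B' \<subseteq> EB" "EB \<subseteq> B"
    by (rule nbhd_closed_inside[OF B(1,3)])
  have disj: "DA \<inter> DB = {}" using A B AB0 by blast
  define M where "M = {m. (f ^^ m) u \<in> A' \<and> (f ^^ m) v \<in> B'}"
  have M: "infinite M" unfolding M_def by (rule ab[OF A'(1,3) B'(1,3)])
  define C where "C e = (if e then A else B)" for e
  define D where "D e = (if e then DA else DB)" for e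
  have hit: "\<exists>N. \<forall>m\<ge>N. m \<in> M \<longrightarrow> (\<exists>y\<in>G. (f ^^ m) y \<in> C e)"
    if G: "openin X G" "G \<noteq> {}" for G e
  proof (cases e)
    case True
    obtain N where "\<And>m. m \<ge> N \<Longrightarrow> (f ^^ m) u \<in> EA \<Longrightarrow> \<exists>y\<in>G. (f ^^ m) y \<in> A"
      by (rule hit_open_set[OF G A(1) A'(2,5) u]) blast
    then show ?thesis using A'(4) True unfolding C_def M_def by (intro exI[of _ N]) auto
  next
    case False
    obtain N where "\<And>m. m \<ge> N \<Longrightarrow> (f ^^ m) v \<in> EB \<Longrightarrow> \<exists>y\<in>G. (f ^^ m) y \<in> B"
      by (rule hit_open_set[OF G B(1) B'(2,5) v]) blast
    then show ?thesis using B'(4) False unfolding C_def M_def by (intro exI[of _ N]) auto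
  qed
  obtain t :: "nat \<Rightarrow> nat" where t: "strict_mono t" "\<And>n. t n \<ge> 1"
    and it: "\<And>\<sigma>. \<exists>y\<in>topspace X. \<forall>n. (f ^^ t n) y \<in> D (\<sigma> n)"
    by (rule itineraries[OF M, of C D, OF _ _ _ hit]) (use A B u in \<open>auto simp: C_def D_def\<close>)
  obtain y where yX: "\<And>\<sigma>. y \<sigma> \<in> topspace X" and y: "\<And>\<sigma> n. (f ^^ t n) (y \<sigma>) \<in> D (\<sigma> n)"
    using it by metis
  define \<W> where "\<W> = {topspace X - DA, topspace X - DB}"
  have \<W>: "open_cover X \<W>" unfolding \<W>_def open_cover_def using A B disj by auto
  have close: "\<exists>U\<in>\<W>. p \<in> U \<and> q \<in> U" if "p \<in> D e" "q \<in> D e" for p q e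
    using that disj closedin_subset[OF A(2)] closedin_subset[OF B(2)]
    unfolding \<W>_def D_def by (cases e) auto
  have apart: "p \<notin> U \<or> q \<notin> U" if "p \<in> D e" "q \<in> D e'" "e \<noteq> e'" "U \<in> \<W>" for p q e e' U
    using that unfolding \<W>_def D_def by (cases e; cases e') auto
  have scrambled: "(y (spread g), y (spread h)) \<in> C1 X f \<W> \<inter> C2 X f \<W>"
    if gh: "g \<noteq> h" for g h
  proof
    obtain n :: "nat \<Rightarrow> nat" where n: "strict_mono n" "\<And>j. n j \<in> t ` {k. spread g k = spread h k}"
      by (rule subsequence_of_infinite[OF infinite_spread_eq[of g h] t(1)]) blast
    have "\<exists>U\<in>\<W>. (f ^^ n j) (y (spread g)) \<in> U \<and> (f ^^ n j) (y (spread h)) \<in> U" for j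
    proof -
      obtain k where "n j = t k" "spread g k = spread h k" using n(2)[of j] by blast
      then show ?thesis using close[OF y[where \<sigma> = "spread g" and n = k], of "(f ^^ t k) (y (spread h))"]
          y[where \<sigma> = "spread h" and n = k] by simp
    qed
    moreover have "n j \<ge> 1" for j using n(2)[of j] t(2) by auto
    ultimately show "(y (spread g), y (spread h)) \<in> C1 X f \<W>"
      unfolding C1_def using n(1) yX by auto
  next
    obtain n :: "nat \<Rightarrow> nat" where n: "strict_mono n" "\<And>j. n j \<in> t ` {k. spread g k \<noteq> spread h k}"
      by (rule subsequence_of_infinite[OF infinite_spread_neq[OF gh] t(1)]) blast
    have "\<forall>U\<in>\<W>. (f ^^ n j) (y (spread g)) \<notin> U \<or> (f ^^ n j) (y (spread h)) \<notin> U" for j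
    proof -
      obtain k where "n j = t k" "spread g k \<noteq> spread h k" using n(2)[of j] by blast
      then show ?thesis
        using apart[OF y[where \<sigma> = "spread g" and n = k] y[where \<sigma> = "spread h" and n = k]] by simp
    qed
    moreover have "n j \<ge> 1" for j using n(2)[of j] t(2) by auto
    ultimately show "(y (spread g), y (spread h)) \<in> C2 X f \<W>"
      unfolding C2_def using n(1) yX by auto
  qed
  \<comment> \<open>A pair in \<open>C2\<close> is off the diagonal, since \<open>\<W>\<close> covers \<open>X\<close>; so distinct \<open>g\<close> give distinct points.\<close>
  have "inj (\<lambda>g. y (spread g))"
  proof (rule injI, rule ccontr)
    fix g h assume eq: "y (spread g) = y (spread h)" and "g \<noteq> h"
    have "(y (spread g), y (spread g)) \<in> C2 X f \<W>"
      using scrambled[OF \<open>g \<noteq> h\<close>] eq by simp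
    then obtain k where k: "\<forall>U\<in>\<W>. (f ^^ k) (y (spread g)) \<notin> U"
      unfolding C2_def by auto
    have "(f ^^ k) (y (spread g)) \<in> \<Union>\<W>"
      using \<W> funpow_in_topspace[OF yX] unfolding open_cover_def by simp
    then show False using k by auto
  qed
  then have "uncountable (range (\<lambda>g. y (spread g)))"
    using uncountable_bool_sequences countable_image_inj_eq by auto
  moreover have "range (\<lambda>g. y (spread g)) \<subseteq> topspace X" using yX by auto
  moreover have "\<forall>p\<in>range (\<lambda>g. y (spread g)). \<forall>q\<in>range (\<lambda>g. y (spread g)).
      p \<noteq> q \<longrightarrow> (p, q) \<in> C1 X f \<W> \<inter> C2 X f \<W>"
  proof (intro ballI impI)
    fix p q
    assume "p \<in> range (\<lambda>g. y (spread g))" "q \<in> range (\<lambda>g. y (spread g))" "p \<noteq> q"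
    then obtain g h where "p = y (spread g)" "q = y (spread h)" "g \<noteq> h" by auto
    then show "(p, q) \<in> C1 X f \<W> \<inter> C2 X f \<W>" using scrambled[of g h] by simp
  qed
  ultimately show ?thesis unfolding Li_Yorke_chaotic_def using \<W> by (intro exI conjI)
qed

end
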